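(* Let $\gamma$ be a modulus function and let $A\subset\mathbb{R}$ be Lebesgue measurable. Then every modulus density point ($\gamma$-density point) of $A$ is also a Lebesgue density point of $A$.
   Context: $|\cdot|$ denotes Lebesgue measure on $\mathbb{R}$ and $A^c=\mathbb{R}\setminus A$. A modulus function is a function $\gamma:[0,\infty)\to[0,\infty)$ such that (i) $\gamma(a)=0\Leftrightarrow a=0$; (ii) $\gamma(a+b)\le\gamma(a)+\gamma(b)$ for all $a,b\ge 0$; (iii) $\gamma$ is right-continuous at $0$; (iv) $\gamma$ is increasing (in the weak sense: $a\le b$ implies $\gamma(a)\le\gamma(b)$). For a Lebesgue measurable set $A\subset\mathbb{R}$, a point $x\in\mathbb{R}$ is a $\gamma$-density point (modulus density point) of $A$ if $\lim_{\alpha\to 0^+}\frac{\gamma(|(x-\alpha,x+\alpha)\cap A^c|)}{\gamma(2\alpha)}=0$. A point $x$ is a Lebesgue density point of $A$ if $\lim_{\alpha\to 0^+}\frac{|A\cap(x-\alpha,x+\alpha)|}{2\alpha}=1$. *)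

theory Defs
  imports "HOL-Analysis.Analysis"
begin

(* A function on [0, \<infinity>) is represented by a total function on the reals;
   its values at negative arguments are unconstrained and never used. *)
definition modulus_function :: "(real \<Rightarrow> real) \<Rightarrow> bool" where
  "modulus_function \<gamma> \<longleftrightarrow>
     (\<forall>a\<ge>0. \<gamma> a \<ge> 0) \<and>
     (\<forall>a\<ge>0. \<gamma> a = 0 \<longleftrightarrow> a = 0) \<and>
     (\<forall>a\<ge>0. \<forall>b\<ge>0. \<gamma> (a + b) \<le> \<gamma> a + \<gamma> b) \<and>
     continuous (at_right 0) \<gamma> \<and>
     mono_on {0..} \<gamma>"

definition modulus_density_point :: "(real \<Rightarrow> real) \<Rightarrow> real set \<Rightarrow> real \<Rightarrow> bool" where
  "modulus_density_point \<gamma> A x \<longleftrightarrow>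
     ((\<lambda>\<alpha>. \<gamma> (measure lebesgue ({x - \<alpha><..<x + \<alpha>} \<inter> - A)) / \<gamma> (2 * \<alpha>))
        \<longlongrightarrow> 0) (at_right 0)"

definition lebesgue_density_point :: "real set \<Rightarrow> real \<Rightarrow> bool" where
  "lebesgue_density_point A x \<longleftrightarrow>
     ((\<lambda>\<alpha>. measure lebesgue (A \<inter> {x - \<alpha><..<x + \<alpha>}) / (2 * \<alpha>))
        \<longlongrightarrow> 1) (at_right 0)"

end

theory Submission
  imports Defs
begin

text \<open>Subadditivity and monotonicity give \<open>\<gamma> b \<le> n * \<gamma> a\<close> whenever \<open>b \<le> n * a\<close> for a natural
  number \<open>n\<close>. Read contrapositively, a quotient \<open>\<gamma> a / \<gamma> b\<close> below \<open>1 / n\<close> forces \<open>a / b < 1 / n\<close>,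
  so a modulus function reflects convergence of quotients to \<open>0\<close>. With \<open>a\<close> the measure of the
  part of an interval that lies outside \<open>A\<close>, and \<open>b\<close> the length of the interval, this says that at
  a modulus density point the complement of \<open>A\<close> has Lebesgue density \<open>0\<close>. Hence \<open>A\<close> has
  density \<open>1\<close> there.\<close>

lemma modulus_function_le_of_nat_mult:
  assumes "modulus_function \<gamma>" "a \<ge> 0"
  shows "\<gamma> (real n * a) \<le> real n * \<gamma> a"
proof (induction n)
  case 0
  show ?case using assms by (auto simp: modulus_function_def)
next
  case (Suc n)
  have "\<gamma> (real n * a + a) \<le> \<gamma> (real n * a) + \<gamma> a"
    using assms by (simp add: modulus_function_def)
  with Suc show ?case by (simp add: algebra_simps)
qed

lemma modulus_function_pos:
  assumes "modulus_function \<gamma>" "a > 0"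
  shows "\<gamma> a > 0"
proof -
  have "\<gamma> a \<ge> 0" "\<gamma> a \<noteq> 0"
    using assms by (simp_all add: modulus_function_def)
  then show ?thesis by simp
qed

lemma modulus_quotient_less_imp_quotient_less:
  assumes \<gamma>: "modulus_function \<gamma>" and "a \<ge> 0" "b > 0" "n > 0"
    and less: "\<gamma> a / \<gamma> b < 1 / real n"
  shows "a / b < 1 / real n"
proof (rule ccontr)
  assume "\<not> a / b < 1 / real n"
  then have "b \<le> real n * a"
    using \<open>b > 0\<close> \<open>n > 0\<close> by (simp add: field_simps)
  then have "\<gamma> b \<le> \<gamma> (real n * a)"
    using \<gamma> \<open>a \<ge> 0\<close> \<open>b > 0\<close> by (simp add: modulus_function_def mono_on_def)
  also have "\<dots> \<le> real n * \<gamma> a"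
    using \<gamma> \<open>a \<ge> 0\<close> by (rule modulus_function_le_of_nat_mult)
  finally show False
    using less modulus_function_pos[OF \<gamma> \<open>b > 0\<close>] \<open>n > 0\<close> by (simp add: field_simps)
qed

text \<open>The bound above is available only for the thresholds \<open>1 / n\<close>, but these are arbitrarily
  small, which is all that convergence to \<open>0\<close> requires.\<close>

lemma modulus_quotient_tendsto_0_imp_quotient_tendsto_0:
  assumes \<gamma>: "modulus_function \<gamma>"
    and f: "\<forall>\<^sub>F t in F. f t \<ge> 0" and g: "\<forall>\<^sub>F t in F. g t > 0"
    and lim: "((\<lambda>t. \<gamma> (f t) / \<gamma> (g t)) \<longlongrightarrow> 0) F"
  shows "((\<lambda>t. f t / g t) \<longlongrightarrow> 0) F"
proof (rule order_tendstoI)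
  fix e :: real
  assume "e < 0"
  from f g show "\<forall>\<^sub>F t in F. e < f t / g t"
    by eventually_elim (use \<open>e < 0\<close> in \<open>simp add: less_le_trans[of e 0]\<close>)
next
  fix e :: real
  assume "0 < e"
  then obtain n where n: "n > 0" "1 / real n < e"
    by (metis ex_inverse_of_nat_less inverse_eq_divide)
  have "\<forall>\<^sub>F t in F. \<gamma> (f t) / \<gamma> (g t) < 1 / real n"
    using order_tendstoD(2)[OF lim, of "1 / real n"] n by simp
  with f g show "\<forall>\<^sub>F t in F. f t / g t < e"
    by eventually_elim
      (use modulus_quotient_less_imp_quotient_less[OF \<gamma> _ _ n(1)] n(2) in \<open>blast intro: less_trans\<close>)
qed

lemma measure_interval_split:
  fixes A :: "real set"
  assumes A: "A \<in> sets lebesgue" and "\<alpha> > 0"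
  shows "measure lebesgue (A \<inter> {x - \<alpha><..<x + \<alpha>})
       = 2 * \<alpha> - measure lebesgue ({x - \<alpha><..<x + \<alpha>} \<inter> - A)"
proof -
  let ?I = "{x - \<alpha><..<x + \<alpha>}"
  have "?I - A \<in> sets lebesgue"
    using A by (intro sets.Diff) simp_all
  then have "measure lebesgue (?I - (?I - A)) = measure lebesgue ?I - measure lebesgue (?I - A)"
    by (intro measurable_measure_Diff) auto
  then show ?thesis
    using \<open>\<alpha> > 0\<close> by (simp add: Diff_Diff_Int Int_commute[of A] Diff_eq[symmetric])
qed

theorem theorem2:
  fixes \<gamma> :: "real \<Rightarrow> real" and A :: "real set" and x :: real
  assumes "modulus_function \<gamma>"
    and "A \<in> sets lebesgue"
    and "modulus_density_point \<gamma> A x"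
  shows "lebesgue_density_point A x"
proof -
  let ?m = "\<lambda>\<alpha>. measure lebesgue ({x - \<alpha><..<x + \<alpha>} \<inter> - A)"
  have pos: "\<forall>\<^sub>F \<alpha>::real in at_right 0. \<alpha> > 0"
    by (rule eventually_at_right_less)
  have "((\<lambda>\<alpha>. ?m \<alpha> / (2 * \<alpha>)) \<longlongrightarrow> 0) (at_right 0)"
    using assms(1)
  proof (rule modulus_quotient_tendsto_0_imp_quotient_tendsto_0)
    show "((\<lambda>\<alpha>. \<gamma> (?m \<alpha>) / \<gamma> (2 * \<alpha>)) \<longlongrightarrow> 0) (at_right 0)"
      using assms(3) unfolding modulus_density_point_def .
    show "\<forall>\<^sub>F \<alpha> in at_right 0. 2 * \<alpha> > (0::real)"
      using pos by simp
  qed simp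
  from tendsto_diff[OF tendsto_const[of 1] this]
  have "((\<lambda>\<alpha>. 1 - ?m \<alpha> / (2 * \<alpha>)) \<longlongrightarrow> 1) (at_right 0)"
    by simp
  moreover have "\<forall>\<^sub>F \<alpha> in at_right 0.
      1 - ?m \<alpha> / (2 * \<alpha>) = measure lebesgue (A \<inter> {x - \<alpha><..<x + \<alpha>}) / (2 * \<alpha>)"
    using pos
    by eventually_elim (simp add: measure_interval_split[OF assms(2)] diff_divide_distrib)
  ultimately show ?thesis
    unfolding lebesgue_density_point_def by (rule Lim_transform_eventually)
qed

end
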